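(* Let $(X,d)$ be a compact metric space, $f:X\to X$ a homeomorphism, and $\pi_0$ an $f$-invariant Borel probability measure on $X$. Let $C_0$ be the smallest channel capacity above which the asymptotic almost sure estimation objective (E2) can be achieved for every $\varepsilon>0$. Then $$C_0\ \le\ \log\bigl(1+\lfloor 2^{h_{\mathrm{top}}(f;\operatorname{supp}\pi_0)}\rfloor\bigr).$$
   Context: All logarithms are to base $2$, and $\log\infty:=\infty$ (so the bound is trivial if the entropy is $+\infty$). The system is $x_{t+1}=f(x_t)$ with random initial state $x_0$ distributed according to $\pi_0$; $\operatorname{supp}\pi_0$ is the support of $\pi_0$. Policies: given a finite nonempty alphabet $\mathcal{M}$ (noiseless channel of capacity $C=\log|\mathcal{M}|$), a coding and estimation policy consists of measurable maps $\delta_t:X^{t+1}\to\mathcal{M}$ and maps $\gamma_t:\mathcal{M}^{t+1}\to X$, $t=0,1,2,\dots$. For initial state $x_0$, put $x_t=f^t(x_0)$, $q_t=\delta_t(x_0,x_1,\dots,x_t)$ and $\hat{x}_t=\hat{x}_t(x_0)=\gamma_t(q_0,q_1,\dots,q_t)$. Objective (E2) for a given $\varepsilon>0$: $\pi_0(\{x_0\in X:\limsup_{t\to\infty}d(f^t(x_0),\hat{x}_t(x_0))\le\varepsilon\})=1$. $C_0$: for $\varepsilon>0$ let $C_\varepsilon$ be the infimum of $\log|\mathcal{M}|$ over all finite alphabets $\mathcal{M}$ for which there is a coding and estimation policy achieving the objective for this $\varepsilon$ (with $\inf\emptyset=\infty$); then $C_0:=\lim_{\varepsilon\downarrow0}C_\varepsilon$.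 Topological entropy on a compact set $K\subset X$: for $n\in\mathbb{N}$, $\varepsilon>0$, a set $F\subset X$ $(n,\varepsilon)$-spans $K$ if for each $x\in K$ there is $y\in F$ with $d(f^i(x),f^i(y))\le\varepsilon$ for $0\le i<n$. Let $r_{\mathrm{span}}(n,\varepsilon;K)$ be the minimal cardinality of such a set, and $h_{\mathrm{top}}(f;K):=\lim_{\varepsilon\downarrow0}\limsup_{n\to\infty}\frac1n\log r_{\mathrm{span}}(n,\varepsilon;K)$. *)

theory Defs
  imports "HOL-Probability.Probability"
begin

definition measure_support :: "'a::topological_space measure \<Rightarrow> 'a set" where
  "measure_support M = {x. \<forall>U. open U \<and> x \<in> U \<longrightarrow> emeasure M U > 0}"

definition spans :: "('a::metric_space \<Rightarrow> 'a) \<Rightarrow> nat \<Rightarrow> real \<Rightarrow> 'a set \<Rightarrow> 'a set \<Rightarrow> bool" where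
  "spans f n \<epsilon> K F \<longleftrightarrow> (\<forall>x\<in>K. \<exists>y\<in>F. \<forall>i<n. dist ((f ^^ i) x) ((f ^^ i) y) \<le> \<epsilon>)"

text \<open>Restricted to finite spanning sets, because \<^const>\<open>card\<close> is 0 on infinite sets. For
  continuous \<open>f\<close>, compact \<open>K\<close> and \<open>\<epsilon> > 0\<close> a finite spanning set exists.\<close>
definition r_span :: "('a::metric_space \<Rightarrow> 'a) \<Rightarrow> nat \<Rightarrow> real \<Rightarrow> 'a set \<Rightarrow> nat" where
  "r_span f n \<epsilon> K = (LEAST k. \<exists>F. finite F \<and> card F = k \<and> spans f n \<epsilon> K F)"

text \<open>The quantities under the limits \<open>\<epsilon> \<down> 0\<close>, here (for continuous \<open>f\<close> and compact \<open>K\<close>) and in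
  \<open>C_zero\<close> below, are nonincreasing in \<open>\<epsilon>\<close> with values in the extended reals, so the limits exist.\<close>
definition h_top :: "('a::metric_space \<Rightarrow> 'a) \<Rightarrow> 'a set \<Rightarrow> ereal" where
  "h_top f K = Lim (at_right 0)
     (\<lambda>\<epsilon>. limsup (\<lambda>n. ereal (1 / real n * log 2 (real (r_span f n \<epsilon> K)))))"

text \<open>Elements of \<open>X\<^sup>t\<^sup>+\<^sup>1\<close> and of the \<open>(t+1)\<close>-fold product of the alphabet are extensional functions on
  \<open>{..t}\<close>. The coder maps are measurable for the product of the Borel \<open>\<sigma>\<close>-algebras (for a compact metric
  space, the Borel \<open>\<sigma>\<close>-algebra of the product). Up to relabelling, every finite alphabet is
  a set of natural numbers.\<close>
definition coder :: "nat set \<Rightarrow> (nat \<Rightarrow> (nat \<Rightarrow> 'a::metric_space) \<Rightarrow> nat) \<Rightarrow> bool" where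
  "coder A \<delta> \<longleftrightarrow> (\<forall>t. \<delta> t \<in> PiM {..t} (\<lambda>_. borel) \<rightarrow>\<^sub>M count_space A)"

definition symbol ::
  "('a \<Rightarrow> 'a) \<Rightarrow> (nat \<Rightarrow> (nat \<Rightarrow> 'a) \<Rightarrow> nat) \<Rightarrow> 'a \<Rightarrow> nat \<Rightarrow> nat" where
  "symbol f \<delta> x\<^sub>0 t = \<delta> t (\<lambda>i\<in>{..t}. (f ^^ i) x\<^sub>0)"

definition estimate ::
  "('a \<Rightarrow> 'a) \<Rightarrow> (nat \<Rightarrow> (nat \<Rightarrow> 'a) \<Rightarrow> nat) \<Rightarrow> (nat \<Rightarrow> (nat \<Rightarrow> nat) \<Rightarrow> 'a) \<Rightarrow> 'a \<Rightarrow> nat \<Rightarrow> 'a" where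
  "estimate f \<delta> \<gamma> x\<^sub>0 t = \<gamma> t (\<lambda>i\<in>{..t}. symbol f \<delta> x\<^sub>0 i)"

definition achieves_as ::
  "('a::metric_space \<Rightarrow> 'a) \<Rightarrow> 'a measure \<Rightarrow> real \<Rightarrow>
   (nat \<Rightarrow> (nat \<Rightarrow> 'a) \<Rightarrow> nat) \<Rightarrow> (nat \<Rightarrow> (nat \<Rightarrow> nat) \<Rightarrow> 'a) \<Rightarrow> bool" where
  "achieves_as f \<pi>\<^sub>0 \<epsilon> \<delta> \<gamma> \<longleftrightarrow>
     emeasure \<pi>\<^sub>0 {x\<^sub>0. limsup (\<lambda>t. ereal (dist ((f ^^ t) x\<^sub>0) (estimate f \<delta> \<gamma> x\<^sub>0 t))) \<le> ereal \<epsilon>} = 1"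

definition C_eps :: "('a::metric_space \<Rightarrow> 'a) \<Rightarrow> 'a measure \<Rightarrow> real \<Rightarrow> ereal" where
  "C_eps f \<pi>\<^sub>0 \<epsilon> = Inf {ereal (log 2 (real (card A))) | A.
     finite A \<and> A \<noteq> {} \<and> (\<exists>\<delta> \<gamma>. coder A \<delta> \<and> achieves_as f \<pi>\<^sub>0 \<epsilon> \<delta> \<gamma>)}"

definition C_zero :: "('a::metric_space \<Rightarrow> 'a) \<Rightarrow> 'a measure \<Rightarrow> ereal" where
  "C_zero f \<pi>\<^sub>0 = Lim (at_right 0) (C_eps f \<pi>\<^sub>0)"

end

(* For m > 2^h the alphabet {..<m} has, for some block length n, at least as many words of length n
   as there are points in an (n, \<epsilon>)-spanning set F of K = supp \<pi>\<^sub>0. The coder knows the whole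
   future of the trajectory, so during each block of n time steps it can send the name of a point
   of F whose orbit stays \<epsilon>-close to the trajectory during the following block. *)
theory Submission
  imports Defs
begin

section \<open>Limits at 0 of antitone functions, and measurability of the estimation event\<close>

text \<open>\<open>h_top\<close> and \<open>C_zero\<close> are given by \<open>Lim\<close>, which
  carries no information before convergence is shown. A value below the supremum is exceeded at some
  \<open>x\<close>, hence by monotonicity on all of \<open>(0, x)\<close>. Only positive arguments
  are compared, since spanning numbers are controlled only at positive scales.\<close>

lemma Lim_at_right_antimono:
  fixes g :: "real \<Rightarrow> ereal"
  assumes "\<And>x y. 0 < x \<Longrightarrow> x \<le> y \<Longrightarrow> g y \<le> g x"
  shows "Lim (at_right 0) g = (SUP x\<in>{0<..}. g x)"
proof -
  have "(g \<longlongrightarrow> (SUP x\<in>{0<..}. g x)) (at_right 0)"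
  proof (rule order_tendstoI)
    fix a assume "a < (SUP x\<in>{0<..}. g x)"
    then obtain x where x: "x > 0" "a < g x" by (auto simp: less_SUP_iff)
    have "a < g y" if "0 < y" "y < x" for y
      using that x assms[of y x] by (simp add: order.strict_trans2)
    then show "eventually (\<lambda>y. a < g y) (at_right 0)"
      using x(1) by (auto simp: eventually_at_right_field)
  next
    fix a assume "(SUP x\<in>{0<..}. g x) < a"
    then have "g y < a" if "0 < y" for y
      using that by (meson SUP_lessD greaterThan_iff)
    then show "eventually (\<lambda>y. g y < a) (at_right 0)"
      by (auto simp: eventually_at_right_field intro!: exI[of _ 1])
  qed
  then show ?thesis by (intro tendsto_Lim) auto
qed

lemma continuous_on_funpow:
  fixes f :: "'a::topological_space \<Rightarrow> 'a"
  assumes "continuous_on UNIV f"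
  shows "continuous_on UNIV (f ^^ n)"
proof (induction n)
  case (Suc n)
  then show ?case
    using continuous_on_compose[OF Suc continuous_on_subset[OF assms]] by simp
qed (simp add: id_def)

lemma funpow_borel_measurable:
  fixes f :: "'a::topological_space \<Rightarrow> 'a"
  assumes "continuous_on UNIV f"
  shows "f ^^ n \<in> borel \<rightarrow>\<^sub>M borel"
  by (intro borel_measurable_continuous_onI continuous_on_funpow assms)

lemma symbol_measurable:
  fixes f :: "'a::metric_space \<Rightarrow> 'a"
  assumes f: "continuous_on UNIV f" and "coder A \<delta>"
  shows "(\<lambda>x. symbol f \<delta> x t) \<in> borel \<rightarrow>\<^sub>M count_space A"
proof -
  have "(\<lambda>x. \<lambda>i\<in>{..t}. (f ^^ i) x) \<in> borel \<rightarrow>\<^sub>M PiM {..t} (\<lambda>_. borel)"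
    by (intro measurable_restrict funpow_borel_measurable f)
  moreover have "\<delta> t \<in> PiM {..t} (\<lambda>_. borel) \<rightarrow>\<^sub>M count_space A"
    using assms(2) by (simp add: coder_def)
  ultimately show ?thesis
    unfolding symbol_def by (rule measurable_compose)
qed

text \<open>The maps \<open>\<gamma> t\<close> are arbitrary, yet the estimate at time
  \<open>t\<close> depends on \<open>x\<close> only through a word from a finite set. This word is
  measurable in \<open>x\<close>, and for each fixed word the distance is continuous in
  \<open>x\<close>.\<close>

lemma estimation_event_measurable:
  fixes f :: "'a::metric_space \<Rightarrow> 'a"
  assumes f: "continuous_on UNIV f" and "coder A \<delta>" and A: "finite A"
  shows "{x. limsup (\<lambda>t. ereal (dist ((f ^^ t) x) (estimate f \<delta> \<gamma> x t))) \<le> ereal \<epsilon>} \<in> sets borel"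
proof -
  have "(\<lambda>x. ereal (dist ((f ^^ t) x) (estimate f \<delta> \<gamma> x t))) \<in> borel_measurable borel" for t
  proof -
    let ?w = "\<lambda>x. \<lambda>i\<in>{..t}. symbol f \<delta> x i"
    have "?w \<in> borel \<rightarrow>\<^sub>M PiM {..t} (\<lambda>_. count_space A)"
      by (intro measurable_restrict symbol_measurable assms)
    then have w: "?w \<in> borel \<rightarrow>\<^sub>M count_space ({..t} \<rightarrow>\<^sub>E A)"
      using A by (simp add: count_space_PiM_finite countable_finite)
    have "(\<lambda>x. ereal (dist ((f ^^ t) x) (\<gamma> t (?w x)))) \<in> borel_measurable borel"
    proof (rule measurable_compose_countable'[OF _ w])
      show "(\<lambda>x. ereal (dist ((f ^^ t) x) (\<gamma> t q))) \<in> borel_measurable borel" for q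
        by (intro borel_measurable_ereal borel_measurable_continuous_onI continuous_on_dist
            continuous_on_funpow f continuous_on_const)
      show "countable ({..t} \<rightarrow>\<^sub>E A)"
        using A by (intro countable_finite finite_PiE) auto
    qed
    then show ?thesis by (simp add: estimate_def)
  qed
  then have "(\<lambda>x. limsup (\<lambda>t. ereal (dist ((f ^^ t) x) (estimate f \<delta> \<gamma> x t)))) \<in> borel_measurable borel"
    by (intro borel_measurable_limsup)
  then show ?thesis
    by measurable
qed

text \<open>Every policy for \<open>\<epsilon>\<close> also serves \<open>\<epsilon>'\<close>, so
  the infimum for \<open>\<epsilon>'\<close> runs over a larger set. Passing to the larger event
  uses its measurability, because \<open>emeasure\<close> is 0 outside the sigma-algebra.\<close>

lemma C_eps_antimono:
  fixes f :: "'a::metric_space \<Rightarrow> 'a"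
  assumes f: "continuous_on UNIV f" and "prob_space M" and M: "sets M = sets borel"
    and "\<epsilon> \<le> \<epsilon>'"
  shows "C_eps f M \<epsilon>' \<le> C_eps f M \<epsilon>"
proof -
  interpret prob_space M by fact
  have "achieves_as f M \<epsilon>' \<delta> \<gamma>"
    if "achieves_as f M \<epsilon> \<delta> \<gamma>" "coder A \<delta>" "finite A" for A \<delta> \<gamma>
  proof -
    let ?L = "\<lambda>x. limsup (\<lambda>t. ereal (dist ((f ^^ t) x) (estimate f \<delta> \<gamma> x t)))"
    have "1 = emeasure M {x. ?L x \<le> \<epsilon>}"
      using that by (simp add: achieves_as_def)
    also have "\<dots> \<le> emeasure M {x. ?L x \<le> \<epsilon>'}"
      using estimation_event_measurable[OF f that(2,3)] assms(4)
      by (intro emeasure_mono) (auto simp: M intro: order_trans)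
    finally show ?thesis
      using emeasure_le_1 by (auto simp: achieves_as_def intro: antisym)
  qed
  then show ?thesis
    unfolding C_eps_def by (intro Inf_superset_mono) blast
qed

section \<open>The support of a measure\<close>

lemma closed_measure_support: "closed (measure_support M)"
proof -
  have "- measure_support M = \<Union>{U. open U \<and> emeasure M U = 0}"
    by (auto simp: measure_support_def zero_less_iff_neq_zero)
  then show ?thesis by (auto simp: closed_def)
qed

text \<open>The open null sets covering \<open>C\<close> may be uncountably many, so their union is
  not null at once; compactness leaves finitely many of them.\<close>

lemma emeasure_compact_disjoint_measure_support:
  assumes "sets M = sets borel" "compact C" "C \<inter> measure_support M = {}"
  shows "emeasure M C = 0"
proof -
  let ?N = "{U. open U \<and> emeasure M U = 0}"
  have "C \<subseteq> \<Union>?N"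
  proof
    fix x assume "x \<in> C"
    then have "x \<notin> measure_support M" using assms(3) by auto
    then show "x \<in> \<Union>?N" by (auto simp: measure_support_def zero_less_iff_neq_zero)
  qed
  then obtain D where D: "D \<subseteq> ?N" "finite D" "C \<subseteq> \<Union>D"
    by (rule compactE[OF assms(2)]) auto
  have "D \<subseteq> null_sets M"
    using D(1) assms(1) by (auto simp: null_sets_def)
  with D(2) have "\<Union>D \<in> null_sets M"
    by (induction D rule: finite_induct) auto
  then have "emeasure M (\<Union>D) = 0"
    by auto
  moreover have "\<Union>D \<in> sets M"
    using D(1) assms(1) by (auto intro!: borel_open)
  ultimately show ?thesis
    using emeasure_mono[OF D(3), of M] by simp
qed

lemma measure_support_nonempty:
  fixes M :: "'a::topological_space measure"
  assumes "compact (UNIV :: 'a set)" "prob_space M" "sets M = sets borel"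
  shows "measure_support M \<noteq> {}"
proof
  interpret prob_space M by fact
  assume "measure_support M = {}"
  then have "emeasure M UNIV = 0"
    using assms by (intro emeasure_compact_disjoint_measure_support) auto
  then show False
    using emeasure_space_1 sets_eq_imp_space_eq[OF assms(3)] by simp
qed

text \<open>The complement of the support is exhausted by countably many compact sets
  \<open>?C k\<close>, the points at distance at least \<open>1 / (k + 1)\<close> from it, and each
  of these is null. For this, \<open>infdist\<close> must be positive off the support, which needs
  the support closed and nonempty.\<close>

lemma emeasure_measure_support:
  fixes M :: "'a::metric_space measure"
  assumes X: "compact (UNIV :: 'a set)" and "prob_space M" and M: "sets M = sets borel"
  shows "emeasure M (measure_support M) = 1"
proof -
  interpret prob_space M by fact
  let ?K = "measure_support M"
  let ?C = "\<lambda>k. {x. 1 / real (Suc k) \<le> infdist x ?K}"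
  have K: "closed ?K" "?K \<noteq> {}"
    using closed_measure_support measure_support_nonempty assms by auto
  have closed: "closed (?C k)" for k
    by (intro closed_Collect_le continuous_intros)
  have "emeasure M (?C k) = 0" for k
  proof (rule emeasure_compact_disjoint_measure_support[OF M])
    show "compact (?C k)"
      using compact_Int_closed[OF X closed] by simp
    show "?C k \<inter> ?K = {}" by (auto simp: not_le)
  qed
  then have "?C k \<in> null_sets M" for k
    using closed M by (simp add: null_sets_def del: of_nat_Suc)
  then have "(\<Union>k. ?C k) \<in> null_sets M"
    by (rule null_sets_UN)
  also have "(\<Union>k. ?C k) = - ?K"
  proof (intro equalityI[rotated] subsetI)
    fix x assume "x \<in> - ?K"
    then have "infdist x ?K > 0"
      using K by (simp add: infdist_pos_not_in_closed)
    then obtain k where "inverse (real (Suc k)) < infdist x ?K"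
      using reals_Archimedean by blast
    then show "x \<in> (\<Union>k. ?C k)" by (auto simp: inverse_eq_divide intro: less_imp_le)
  qed (auto simp: not_le)
  finally have "emeasure M (UNIV - - ?K) = emeasure M UNIV"
    using M by (intro emeasure_Diff_null_set) simp_all
  then show ?thesis
    using sets_eq_imp_space_eq[OF M] emeasure_space_1 by (simp add: Diff_eq)
qed

text \<open>The preimage of a neighbourhood of \<open>f y\<close> is a neighbourhood of
  \<open>y\<close> and, by invariance, has the same measure. This lets the spanning property be
  applied afresh at the start of every block.\<close>

lemma funpow_measure_support:
  fixes f :: "'a::topological_space \<Rightarrow> 'a"
  assumes f: "continuous_on UNIV f" and M: "sets M = sets borel" and inv: "distr M borel f = M"
    and "x \<in> measure_support M"
  shows "(f ^^ n) x \<in> measure_support M"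
proof (induction n)
  case (Suc n)
  have "emeasure M U > 0" if U: "open U" "(f ^^ Suc n) x \<in> U" for U
  proof -
    have "open (f -` U)"
      using f U(1) by (simp add: open_vimage)
    then have "emeasure M (f -` U) > 0"
      using Suc U by (simp add: measure_support_def)
    moreover have "f \<in> M \<rightarrow>\<^sub>M borel"
      using borel_measurable_continuous_onI[OF f] M by (simp cong: measurable_cong_sets)
    then have "emeasure (distr M borel f) U = emeasure M (f -` U)"
      using U sets_eq_imp_space_eq[OF M] by (simp add: emeasure_distr)
    ultimately show ?thesis by (simp add: inv)
  qed
  then show ?case by (simp add: measure_support_def)
qed (use assms in simp)

section \<open>Spanning numbers and topological entropy\<close>

text \<open>The \<open>?B y\<close> are open Bowen balls, finite intersections of open sets by
  continuity of the iterates, and finitely many cover \<open>K\<close>. Hence the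
  \<open>LEAST\<close> in \<open>r_span\<close> ranges over a nonempty set.\<close>

lemma finite_spanning_set:
  fixes f :: "'a::metric_space \<Rightarrow> 'a"
  assumes f: "continuous_on UNIV f" and K: "compact K" and "\<epsilon> > 0"
  shows "\<exists>F. finite F \<and> spans f n \<epsilon> K F"
proof -
  let ?B = "\<lambda>y. \<Inter>i<n. {x. dist ((f ^^ i) x) ((f ^^ i) y) < \<epsilon>}"
  have "open (?B y)" for y
    by (intro open_INT ballI open_Collect_less continuous_on_dist
        continuous_on_funpow f continuous_on_const) auto
  moreover have "K \<subseteq> (\<Union>y\<in>K. ?B y)"
    using \<open>\<epsilon> > 0\<close> by auto
  ultimately obtain F where F: "F \<subseteq> K" "finite F" "K \<subseteq> (\<Union>y\<in>F. ?B y)"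
    by (rule compactE_image[OF K])
  have "spans f n \<epsilon> K F"
    unfolding spans_def
  proof
    fix x assume "x \<in> K"
    then obtain y where "y \<in> F" "x \<in> ?B y" using F(3) by auto
    then show "\<exists>y\<in>F. \<forall>i<n. dist ((f ^^ i) x) ((f ^^ i) y) \<le> \<epsilon>"
      by (intro bexI[of _ y]) (auto intro: less_imp_le)
  qed
  with F show ?thesis by blast
qed

lemma r_span_attained:
  fixes f :: "'a::metric_space \<Rightarrow> 'a"
  assumes "continuous_on UNIV f" "compact K" "\<epsilon> > 0"
  shows "\<exists>F. finite F \<and> card F = r_span f n \<epsilon> K \<and> spans f n \<epsilon> K F"
proof -
  obtain F where "finite F" "spans f n \<epsilon> K F"
    using finite_spanning_set[OF assms] by blast
  then have "\<exists>k F. finite F \<and> card F = k \<and> spans f n \<epsilon> K F"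
    by blast
  then show ?thesis
    unfolding r_span_def by (rule LeastI_ex)
qed

lemma r_span_le: "finite F \<Longrightarrow> spans f n \<epsilon> K F \<Longrightarrow> r_span f n \<epsilon> K \<le> card F"
  unfolding r_span_def by (rule Least_le) blast

lemma r_span_antimono:
  fixes f :: "'a::metric_space \<Rightarrow> 'a"
  assumes "continuous_on UNIV f" "compact K" "0 < \<epsilon>" "\<epsilon> \<le> \<epsilon>'"
  shows "r_span f n \<epsilon>' K \<le> r_span f n \<epsilon> K"
proof -
  obtain F where F: "finite F" "card F = r_span f n \<epsilon> K" "spans f n \<epsilon> K F"
    using r_span_attained[OF assms(1-3)] by blast
  then have "spans f n \<epsilon>' K F"
    using \<open>\<epsilon> \<le> \<epsilon>'\<close> unfolding spans_def by (meson order_trans)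
  then show ?thesis using r_span_le F by metis
qed

text \<open>Keeps logarithms of spanning numbers away from the default value of \<open>log\<close>
  at 0.\<close>

lemma r_span_pos:
  fixes f :: "'a::metric_space \<Rightarrow> 'a"
  assumes "continuous_on UNIV f" "compact K" "\<epsilon> > 0" "K \<noteq> {}"
  shows "r_span f n \<epsilon> K > 0"
proof -
  obtain F where F: "finite F" "card F = r_span f n \<epsilon> K" "spans f n \<epsilon> K F"
    using r_span_attained[OF assms(1-3)] by blast
  then have "F \<noteq> {}" using \<open>K \<noteq> {}\<close> by (auto simp: spans_def)
  then show ?thesis using F by (metis card_gt_0_iff)
qed

text \<open>Since spanning numbers grow as the scale shrinks, the limit defining
  \<open>h_top\<close> is a supremum over all scales.\<close>

lemma h_top_upper:
  fixes f :: "'a::metric_space \<Rightarrow> 'a"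
  assumes f: "continuous_on UNIV f" and K: "compact K" "K \<noteq> {}" and "\<epsilon> > 0"
  shows "limsup (\<lambda>n. ereal (1 / real n * log 2 (real (r_span f n \<epsilon> K)))) \<le> h_top f K"
proof -
  let ?l = "\<lambda>\<epsilon>. limsup (\<lambda>n. ereal (1 / real n * log 2 (real (r_span f n \<epsilon> K))))"
  have "?l \<epsilon>' \<le> ?l \<epsilon>" if "0 < \<epsilon>" "\<epsilon> \<le> \<epsilon>'" for \<epsilon> \<epsilon>'
  proof (intro Limsup_mono always_eventually allI)
    fix n
    have "log 2 (real (r_span f n \<epsilon>' K)) \<le> log 2 (real (r_span f n \<epsilon> K))"
      using that r_span_pos[OF f K(1) _ K(2), of \<epsilon> n] r_span_pos[OF f K(1) _ K(2), of \<epsilon>' n]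
        r_span_antimono[OF f K(1) that, of n]
      by (subst log_le_cancel_iff) auto
    then show "ereal (1 / real n * log 2 (real (r_span f n \<epsilon>' K)))
        \<le> ereal (1 / real n * log 2 (real (r_span f n \<epsilon> K)))"
      by (simp add: divide_right_mono)
  qed
  then have "h_top f K = (SUP \<epsilon>\<in>{0<..}. ?l \<epsilon>)"
    unfolding h_top_def by (rule Lim_at_right_antimono)
  then show ?thesis using \<open>\<epsilon> > 0\<close> by (auto intro: SUP_upper)
qed

text \<open>Logarithms of positive integers are nonnegative; at \<open>n = 0\<close> the factor
  \<open>1 / 0\<close> is 0. The scale 1 is an arbitrary choice.\<close>

lemma h_top_nonneg:
  fixes f :: "'a::metric_space \<Rightarrow> 'a"
  assumes f: "continuous_on UNIV f" and K: "compact K" "K \<noteq> {}"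
  shows "h_top f K \<ge> 0"
proof -
  have "ereal (1 / real n * log 2 (real (r_span f n 1 K))) \<ge> 0" for n
    using r_span_pos[OF f K(1) zero_less_one K(2), of n] by simp
  then have "0 \<le> limsup (\<lambda>n. ereal (1 / real n * log 2 (real (r_span f n 1 K))))"
    by (intro le_Limsup) auto
  then show ?thesis
    using h_top_upper[OF f K zero_less_one] by (rule order_trans)
qed

text \<open>Provides a block length \<open>n\<close> for which the words of length \<open>n\<close>
  over \<open>m\<close> letters suffice to name the points of a minimal spanning set. The strict gap
  between entropy and \<open>log 2 m\<close> makes the inequality hold for all large
  \<open>n\<close>; one positive \<open>n\<close> is enough.\<close>

lemma r_span_le_power:
  fixes f :: "'a::metric_space \<Rightarrow> 'a"
  assumes f: "continuous_on UNIV f" and K: "compact K" "K \<noteq> {}" and "\<epsilon> > 0"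
    and m: "h_top f K < ereal (log 2 (real m))" "m > 0"
  shows "\<exists>n>0. r_span f n \<epsilon> K \<le> m ^ n"
proof -
  have "limsup (\<lambda>n. ereal (1 / real n * log 2 (real (r_span f n \<epsilon> K)))) < ereal (log 2 (real m))"
    using h_top_upper[OF f K \<open>\<epsilon> > 0\<close>] m(1) by (rule order.strict_trans1)
  then have "\<forall>\<^sub>F n in sequentially. 1 / real n * log 2 (real (r_span f n \<epsilon> K)) < log 2 (real m)"
    using Limsup_lessD by fastforce
  then have "\<forall>\<^sub>F n in sequentially.
      n > 0 \<and> 1 / real n * log 2 (real (r_span f n \<epsilon> K)) < log 2 (real m)"
    using eventually_conj[OF eventually_gt_at_top[of 0]] by blast
  then obtain n where n: "n > 0" "1 / real n * log 2 (real (r_span f n \<epsilon> K)) < log 2 (real m)"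
    using eventually_happens'[OF sequentially_bot] by blast
  then have "log 2 (real (r_span f n \<epsilon> K)) < real n * log 2 (real m)"
    by (simp add: field_simps)
  also have "\<dots> = log 2 (real (m ^ n))"
    using m(2) by (simp add: log_nat_power)
  finally have "real (r_span f n \<epsilon> K) < real (m ^ n)"
    using m(2) r_span_pos[OF f K(1) \<open>\<epsilon> > 0\<close> K(2)] by (subst (asm) log_less_cancel_iff) auto
  then show ?thesis
    using n(1) by (auto simp del: of_nat_power intro: less_imp_le)
qed

section \<open>The block code\<close>

text \<open>Choosing the first suitable point in a fixed enumeration of \<open>F\<close> is
  measurable, because the set of states shadowed by a given point is closed.\<close>

lemma measurable_spanning_selector:
  fixes f :: "'a::metric_space \<Rightarrow> 'a"
  assumes f: "continuous_on UNIV f" and F: "finite F" "F \<noteq> {}" and "spans f n \<epsilon> K F"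
  obtains s where "s \<in> borel \<rightarrow>\<^sub>M count_space F"
    "\<And>x i. x \<in> K \<Longrightarrow> i < n \<Longrightarrow> dist ((f ^^ i) x) ((f ^^ i) (s x)) \<le> \<epsilon>"
proof -
  obtain ys where ys: "set ys = F" using F(1) finite_list by blast
  define P where "P x y \<longleftrightarrow> (\<forall>i<n. dist ((f ^^ i) x) ((f ^^ i) y) \<le> \<epsilon>)" for x y
  \<comment> \<open>The default \<open>hd ys\<close> lies in \<open>F\<close> and is never taken on
    \<open>K\<close>, where some point of \<open>F\<close> is always suitable.\<close>
  define s where "s x = (case find (P x) ys of Some y \<Rightarrow> y | None \<Rightarrow> hd ys)" for x
  have P: "{x. P x y} \<in> sets borel" for y
  proof -
    have "{x. P x y} = (\<Inter>i<n. {x. dist ((f ^^ i) x) ((f ^^ i) y) \<le> \<epsilon>})"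
      by (auto simp: P_def)
    also have "closed \<dots>"
      by (intro closed_INT ballI closed_Collect_le continuous_on_dist
          continuous_on_funpow f continuous_on_const)
    finally show ?thesis by simp
  qed
  have "s \<in> borel \<rightarrow>\<^sub>M count_space UNIV"
  proof -
    \<comment> \<open>The default becomes a fixed \<open>c\<close>, since \<open>hd\<close> would
      change with the list during the induction.\<close>
    have "(\<lambda>x. case find (P x) zs of Some y \<Rightarrow> y | None \<Rightarrow> c) \<in> borel \<rightarrow>\<^sub>M count_space UNIV"
      for zs and c :: 'a
    proof (induction zs)
      case (Cons z zs)
      have "(\<lambda>x. if P x z then z else (case find (P x) zs of Some y \<Rightarrow> y | None \<Rightarrow> c))
          \<in> borel \<rightarrow>\<^sub>M count_space UNIV"
        using P[of z] by (intro measurable_If Cons) auto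
      then show ?case by (simp add: if_distrib cong: if_cong)
    qed simp
    then show ?thesis unfolding s_def by auto
  qed
  moreover have "s x \<in> F" for x
    using ys F(2) by (auto simp: s_def find_Some_iff split: option.split)
  ultimately have "s \<in> borel \<rightarrow>\<^sub>M count_space F"
    by (auto simp: measurable_def)
  moreover have "dist ((f ^^ i) x) ((f ^^ i) (s x)) \<le> \<epsilon>" if x: "x \<in> K" "i < n" for x i
  proof -
    obtain y where "y \<in> F" "P x y"
      using assms(4) x by (auto simp: spans_def P_def)
    then have "P x (s x)"
      using ys by (auto simp: s_def find_Some_iff find_None_iff split: option.split)
    then show ?thesis using x by (auto simp: P_def)
  qed
  ultimately show ?thesis using that by blast
qed

text \<open>The word sent during block \<open>j\<close> names a point shadowing block
  \<open>j + 1\<close>, so it is complete exactly when that block begins. No word precedes block 0,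
  hence the restriction to \<open>t \<ge> n\<close>.\<close>

lemma block_coding:
  fixes f :: "'a::metric_space \<Rightarrow> 'a"
  assumes f: "continuous_on UNIV f" and K: "\<And>x i. x \<in> K \<Longrightarrow> (f ^^ i) x \<in> K"
    and F: "finite F" "F \<noteq> {}" "spans f n \<epsilon> K F"
    and n: "n > 0" and card: "card F \<le> m ^ n"
  obtains \<delta> \<gamma> where "coder {..<m} \<delta>"
    "\<And>x t. x \<in> K \<Longrightarrow> t \<ge> n \<Longrightarrow> dist ((f ^^ t) x) (estimate f \<delta> \<gamma> x t) \<le> \<epsilon>"
proof -
  obtain s where s: "s \<in> borel \<rightarrow>\<^sub>M count_space F"
    and s_near: "\<And>x i. x \<in> K \<Longrightarrow> i < n \<Longrightarrow> dist ((f ^^ i) x) ((f ^^ i) (s x)) \<le> \<epsilon>"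
    using measurable_spanning_selector[OF f F] by blast
  have sF: "s x \<in> F" for x
    using measurable_space[OF s, of x] by simp
  let ?W = "{..<n} \<rightarrow>\<^sub>E {..<m}"
  have "finite ?W" "card ?W = m ^ n"
    by (auto simp: card_PiE intro!: finite_PiE)
  \<comment> \<open>\<open>w\<close> gives the points of \<open>F\<close> distinct names of
    \<open>n\<close> letters each; \<open>card F \<le> m ^ n\<close> makes room for them.\<close>
  then obtain w where w: "w ` F \<subseteq> ?W" "inj_on w F"
    using card_le_inj[OF F(1), of ?W] card by auto
  \<comment> \<open>\<open>n * Suc (t div n)\<close> is the starting time of the block after the one
    containing \<open>t\<close>; the state there is computed from \<open>z 0\<close>. The symbol
    sent is letter \<open>t mod n\<close> of its name.\<close>
  define \<delta> where "\<delta> t z = w (s ((f ^^ (n * Suc (t div n))) (z 0))) (t mod n)"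
    for t and z :: "nat \<Rightarrow> 'a"
  \<comment> \<open>The decoder reads the word of the preceding block, recovers the point of
    \<open>F\<close>, and advances it to the current position in the block. Truncated subtraction
    covers \<open>t < n\<close>, where nothing is claimed.\<close>
  define \<gamma> where "\<gamma> t q = (f ^^ (t mod n)) (inv_into F w (\<lambda>l\<in>{..<n}. q (n * (t div n - 1) + l)))"
    for t and q :: "nat \<Rightarrow> nat"
  show ?thesis
  proof (rule that)
    show "coder {..<m} \<delta>"
      unfolding coder_def
    proof
      fix t :: nat
      have "(\<lambda>z. z 0) \<in> PiM {..t} (\<lambda>_. borel) \<rightarrow>\<^sub>M (borel :: 'a measure)"
        by (rule measurable_component_singleton) auto
      then have "(\<lambda>z. s ((f ^^ (n * Suc (t div n))) (z 0))) \<in> PiM {..t} (\<lambda>_. borel) \<rightarrow>\<^sub>M count_space F"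
        by (rule measurable_compose[OF measurable_compose[OF _ funpow_borel_measurable[OF f]] s])
      moreover have "(\<lambda>y. w y (t mod n)) \<in> count_space F \<rightarrow>\<^sub>M count_space {..<m}"
        using w(1) n by (auto simp: PiE_iff image_subset_iff)
      ultimately show "\<delta> t \<in> PiM {..t} (\<lambda>_. borel) \<rightarrow>\<^sub>M count_space {..<m}"
        unfolding \<delta>_def by (rule measurable_compose)
    qed
    fix x t assume x: "x \<in> K" and t: "t \<ge> n"
    define j where "j = t div n - 1"
    have j: "t div n = Suc j"
      using t n by (simp add: j_def div_greater_zero_iff)
    have tj: "t = n * Suc j + t mod n"
      using j by (metis mult_div_mod_eq)
    define y where "y = (f ^^ (n * Suc j)) x"
    have "symbol f \<delta> x (n * j + l) = w (s y) l" if "l < n" for l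
      using that n by (simp add: symbol_def \<delta>_def y_def div_mult_self4)
    \<comment> \<open>All letters of the word have arrived by time \<open>t\<close>, so the
      restriction to \<open>{..t}\<close> hides none of them.\<close>
    moreover have "n * j + l \<le> t" if "l < n" for l
      using that tj by (simp add: algebra_simps)
    ultimately have "(\<lambda>l\<in>{..<n}. (\<lambda>i\<in>{..t}. symbol f \<delta> x i) (n * (t div n - 1) + l))
        = (\<lambda>l\<in>{..<n}. w (s y) l)"
      by (simp add: j fun_eq_iff)
    also have "\<dots> = w (s y)"
      using w(1) sF by (intro PiE_restrict) auto
    finally have "estimate f \<delta> \<gamma> x t = (f ^^ (t mod n)) (s y)"
      using w(2) sF by (simp add: estimate_def \<gamma>_def)
    moreover have "(f ^^ t) x = (f ^^ (t mod n)) y"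
      unfolding y_def using tj by (metis add.commute comp_apply funpow_add)
    ultimately show "dist ((f ^^ t) x) (estimate f \<delta> \<gamma> x t) \<le> \<epsilon>"
      using s_near[of y "t mod n"] K[OF x] n by (simp add: y_def)
  qed
qed

section \<open>The capacity bound\<close>

text \<open>The block code keeps the error within \<open>\<epsilon>\<close> from time
  \<open>n\<close> on for every initial state in the support, and the support has full
  measure.\<close>

lemma C_eps_le_log:
  fixes f :: "'a::metric_space \<Rightarrow> 'a" and M :: "'a measure"
  assumes X: "compact (UNIV :: 'a set)" and f: "continuous_on UNIV f"
    and prob: "prob_space M" and M: "sets M = sets borel" and inv: "distr M borel f = M"
    and "\<epsilon> > 0" and m: "h_top f (measure_support M) < ereal (log 2 (real m))" "m > 0"
  shows "C_eps f M \<epsilon> \<le> ereal (log 2 (real m))"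
proof -
  interpret prob_space M by fact
  let ?K = "measure_support M"
  have K: "compact ?K" "?K \<noteq> {}"
    using compact_Int_closed[OF X closed_measure_support] measure_support_nonempty[OF X prob M]
    by auto
  obtain n where n: "n > 0" "r_span f n \<epsilon> ?K \<le> m ^ n"
    using r_span_le_power[OF f K \<open>\<epsilon> > 0\<close> m] by blast
  obtain F where F: "finite F" "card F = r_span f n \<epsilon> ?K" "spans f n \<epsilon> ?K F"
    using r_span_attained[OF f K(1) \<open>\<epsilon> > 0\<close>] by blast
  have "F \<noteq> {}"
    using F(3) K(2) by (auto simp: spans_def)
  then obtain \<delta> \<gamma> where c: "coder {..<m} \<delta>"
    and near: "\<And>x t. x \<in> ?K \<Longrightarrow> t \<ge> n \<Longrightarrow> dist ((f ^^ t) x) (estimate f \<delta> \<gamma> x t) \<le> \<epsilon>"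
    using block_coding[OF f funpow_measure_support[OF f M inv] F(1) _ F(3) n(1)] F(2) n(2) by metis
  let ?S = "{x. limsup (\<lambda>t. ereal (dist ((f ^^ t) x) (estimate f \<delta> \<gamma> x t))) \<le> ereal \<epsilon>}"
  have "?K \<subseteq> ?S"
  proof
    fix x assume "x \<in> ?K"
    then have "\<forall>\<^sub>F t in sequentially. ereal (dist ((f ^^ t) x) (estimate f \<delta> \<gamma> x t)) \<le> ereal \<epsilon>"
      using near by (auto simp: eventually_sequentially)
    then show "x \<in> ?S" by (auto intro: Limsup_bounded)
  qed
  then have "1 \<le> emeasure M ?S"
    using emeasure_mono[of ?K ?S M] estimation_event_measurable[OF f c] M
      emeasure_measure_support[OF X prob M] by simp
  then have "achieves_as f M \<epsilon> \<delta> \<gamma>"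
    using emeasure_le_1 by (auto simp: achieves_as_def intro: antisym)
  then show ?thesis
    unfolding C_eps_def using c m(2)
    by (intro Inf_lower CollectI exI[of _ "{..<m}"]) auto
qed

theorem mainTheorem2:
  fixes f :: "'a::metric_space \<Rightarrow> 'a" and \<pi>\<^sub>0 :: "'a measure"
  assumes "compact (UNIV :: 'a set)"
    and "\<exists>g. homeomorphism UNIV UNIV f g"
    and "prob_space \<pi>\<^sub>0" and "sets \<pi>\<^sub>0 = sets borel"
    and "distr \<pi>\<^sub>0 borel f = \<pi>\<^sub>0"
  shows "C_zero f \<pi>\<^sub>0 \<le>
    (let h = h_top f (measure_support \<pi>\<^sub>0) in
       if h = \<infinity> then \<infinity>
       else ereal (log 2 (1 + of_int \<lfloor>2 powr real_of_ereal h\<rfloor>)))"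
proof (cases "h_top f (measure_support \<pi>\<^sub>0) = \<infinity>")
  case False
  have f: "continuous_on UNIV f"
    using assms(2) homeomorphism_cont1 by blast
  \<comment> \<open>This rules out minus infinity, so the entropy is a real number
    \<open>r\<close>.\<close>
  have "h_top f (measure_support \<pi>\<^sub>0) \<ge> 0"
    using compact_Int_closed[OF assms(1) closed_measure_support] measure_support_nonempty assms f
    by (intro h_top_nonneg) auto
  then obtain r where r: "h_top f (measure_support \<pi>\<^sub>0) = ereal r"
    using False by (cases "h_top f (measure_support \<pi>\<^sub>0)") auto
  \<comment> \<open>The least integer strictly above \<open>2 powr r\<close>. Strictness, also when
    \<open>2 powr r\<close> is an integer, yields the gap \<open>r < log 2 m\<close> that the code
    requires.\<close>
  define m where "m = nat (1 + \<lfloor>2 powr r\<rfloor>)"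
  have m: "real m = 1 + of_int \<lfloor>2 powr r\<rfloor>"
    by (simp add: m_def)
  then have gt: "2 powr r < real m" by linarith
  then have "m > 0" by (metis of_nat_0_less_iff order.strict_trans powr_gt_zero zero_neq_numeral)
  then have "r < log 2 (real m)"
    using gt by (simp add: less_log_iff)
  \<comment> \<open>The block length depends on \<open>\<epsilon>\<close> but the alphabet size
    \<open>m\<close> does not, so the bound survives the supremum over
    \<open>\<epsilon>\<close>.\<close>
  then have "C_eps f \<pi>\<^sub>0 \<epsilon> \<le> ereal (log 2 (real m))" if "\<epsilon> > 0" for \<epsilon>
    using C_eps_le_log[OF assms(1) f assms(3-5) that] \<open>m > 0\<close> r by simp
  moreover have "C_zero f \<pi>\<^sub>0 = (SUP \<epsilon>\<in>{0<..}. C_eps f \<pi>\<^sub>0 \<epsilon>)"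
    unfolding C_zero_def by (intro Lim_at_right_antimono C_eps_antimono f assms)
  ultimately have "C_zero f \<pi>\<^sub>0 \<le> ereal (log 2 (real m))"
    by (auto intro: SUP_least)
  then show ?thesis by (simp add: r m)
qed simp

end
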